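(* For every integer $s\ge1$ let $F_s:\mathbb R\to[0,1]$, $F_s(c)=d_{\mathrm{TV}}(\nu_s,\eta_c^s)$. Different values of $s$ define different profiles up to affine transformation: if $r,s\ge1$ are integers and there exist $a>0$ and $b\in\mathbb R$ such that $F_r(ac+b)=F_s(c)$ for all $c\in\mathbb R$, then $r=s$.
   Context: For an integer $s\ge1$ and $c\in\mathbb R$, the probability measures $\nu_s$ and $\eta_c^s$ on $\mathbb R$ are $$\nu_s=\frac{\sqrt{4-(x-\sqrt s)^2}}{2\pi(x\sqrt s+1)}\mathbf 1_{|x-\sqrt s|\le 2}\,\mathrm dx+(1-s^{-1})\,\delta_{-1/\sqrt s},$$ $$\eta_c^s=f_c\,\mathrm d\nu_s+\mathbf 1_{c<0}\,\frac{e^{-c}-e^c}{e^{-c}+\sqrt s}\,\delta_{e^c+\sqrt s+e^{-c}},\qquad f_c(x)=\frac{e^c+\sqrt s}{e^c+e^{-c}+\sqrt s-x}.$$ The total variation distance is $d_{\mathrm{TV}}(\mu,\nu)=\sup_B|\mu(B)-\nu(B)|$ over Borel sets $B\subset\mathbb R$. Two profiles $f,f'$ are considered equivalent (equal up to affine transformation) if $f'=f(a\,\cdot+b)$ for some $a>0$, $b\in\mathbb R$. *)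

theory Defs
  imports "HOL-Probability.Probability"
begin

definition add_measure :: "'a measure \<Rightarrow> 'a measure \<Rightarrow> 'a measure" where
  "add_measure M N = measure_of (space M) (sets M) (\<lambda>A. emeasure M A + emeasure N A)"

lemma space_add_measure [simp]: "space (add_measure M N) = space M"
  and sets_add_measure [simp, measurable_cong]: "sets (add_measure M N) = sets M"
  by (simp_all add: add_measure_def)

lemma emeasure_add_measure:
  assumes "sets N = sets M"
  shows "emeasure (add_measure M N) A = emeasure M A + emeasure N A"
proof (cases "A \<in> sets M")
  case True
  have "countably_additive (sets M) (\<lambda>A. emeasure M A + emeasure N A)"
    unfolding countably_additive_def
    by (auto simp: suminf_add[symmetric] suminf_emeasure assms)
  then have "measure_space (space M) (sets M) (\<lambda>A. emeasure M A + emeasure N A)"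
    by (auto simp: measure_space_def positive_def sets.sigma_algebra_axioms)
  then show ?thesis
    using True unfolding add_measure_def
    by (intro emeasure_measure_of_sigma)
       (auto simp: measure_space_def sets.sigma_algebra_axioms)
qed (simp add: assms emeasure_notin_sets)

definition nu :: "nat \<Rightarrow> real measure" where
  "nu s = add_measure
     (density lborel (\<lambda>x. ennreal
        (sqrt (4 - (x - sqrt s)\<^sup>2) / (2 * pi * (x * sqrt s + 1))
          * indicator {y. \<bar>y - sqrt s\<bar> \<le> 2} x)))
     (scale_measure (ennreal (1 - 1 / real s)) (return borel (- 1 / sqrt s)))"

definition f_dens :: "nat \<Rightarrow> real \<Rightarrow> real \<Rightarrow> real" where
  "f_dens s c x = (exp c + sqrt s) / (exp c + exp (- c) + sqrt s - x)"

text \<open>For \<open>s \<ge> 1\<close>, \<open>f_dens s c\<close> is nonnegative on the support of \<open>nu s\<close>; its only pole there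
  is the right endpoint \<open>sqrt s + 2\<close> when \<open>c = 0\<close>, a null set for \<open>nu s\<close>.  The truncation of
  negative values by \<open>ennreal\<close> therefore changes nothing below.\<close>

definition eta :: "real \<Rightarrow> nat \<Rightarrow> real measure" where
  "eta c s = add_measure
     (density (nu s) (\<lambda>x. ennreal (f_dens s c x)))
     (scale_measure
        (ennreal (indicator {..<0} c * ((exp (- c) - exp c) / (exp (- c) + sqrt s))))
        (return borel (exp c + sqrt s + exp (- c))))"

definition tv_dist :: "real measure \<Rightarrow> real measure \<Rightarrow> real" where
  "tv_dist M N = (SUP B\<in>sets borel. \<bar>measure M B - measure N B\<bar>)"

definition profile :: "nat \<Rightarrow> real \<Rightarrow> real" where
  "profile s c = tv_dist (nu s) (eta c s)"

end

theory Submission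
  imports Defs
begin

text \<open>The parameter \<open>s\<close> can be read off from the profile near \<open>c = -\<infinity>\<close>, where the profile is
  explicit. Put \<open>t = exp c\<close>. As soon as \<open>1 / t \<ge> sqrt s + 2\<close>, the density \<open>f_dens s c\<close> takes
  values in \<open>[0, 1]\<close> on the support of \<open>nu s\<close>, so \<open>eta c s\<close> arises from \<open>nu s\<close> by removing
  mass and placing all of it in an atom outside that support; the total variation
  distance is then the mass \<open>(1 - t\<^sup>2) / (1 + sqrt s * t)\<close> of that atom
  (\<open>tv_dist_truncation\<close>, \<open>profile_left_tail\<close>).

  This argument needs that \<open>nu s\<close> and \<open>eta c s\<close> have total mass one. Both masses follow by partial
  fractions from the Cauchy transform of the semicircle law, \<open>has_integral_semicircle_cauchy\<close>,
  taken at \<open>q + 1 / q\<close> for \<open>q = sqrt s\<close> and \<open>q = - 1 / t\<close>.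

  Let \<open>H s t = t * (t + sqrt s) / (1 + sqrt s * t)\<close> be one minus the profile. If
  \<open>H r (exp (a * c + b)) = H s (exp c)\<close> for all very negative \<open>c\<close>, then comparing leading terms, using
  \<open>H s t \<sim> sqrt s * t\<close>, forces \<open>a = 1\<close> and \<open>B * sqrt r = sqrt s\<close> for \<open>B = exp b\<close>. The two
  denominators then coincide, and the numerators give \<open>B * B = 1\<close>, hence \<open>r = s\<close>.\<close>

section \<open>The Cauchy transform of the semicircle law\<close>

text \<open>The substitution \<open>x - m = 2 * cos \<theta>\<close> turns the integrand into
  \<open>4 * (sin \<theta>)\<^sup>2 / (q + 1 / q + 2 * cos \<theta>)\<close>, a trigonometric polynomial plus a multiple of the
  Poisson kernel, whose primitive is elementary; \<open>F\<close> below is that primitive in the variable \<open>x\<close>.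
  Admitting negative \<open>q\<close> covers poles on either side of the interval.\<close>
lemma has_integral_semicircle_cauchy:
  fixes q m :: real
  assumes "\<bar>q\<bar> \<ge> 1"
  shows "((\<lambda>x. sqrt (4 - (x - m)\<^sup>2) / (q + 1 / q + (x - m))) has_integral (2 * pi / q)) {m - 2..m + 2}"
proof -
  define S where "S x = sqrt (4 - (x - m)\<^sup>2)" for x
  define F where "F x = S x - 2 / q * arccos ((x - m) / 2)
      - 2 * (q - 1 / q) * arctan (S x / (2 * q + (x - m)))" for x
  have q0: "q \<noteq> 0" using assms by auto
  have "((\<lambda>x. S x / (q + 1 / q + (x - m))) has_integral (F (m + 2) - F (m - 2))) {m - 2..m + 2}"
  proof (rule fundamental_theorem_of_calculus_interior)
    show "m - 2 \<le> m + 2" by simp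
    have cS: "continuous_on {m - 2..m + 2} S"
      unfolding S_def by (intro continuous_intros)
    have cA: "continuous_on {m - 2..m + 2} (\<lambda>x. arccos ((x - m) / 2))"
      by (intro continuous_intros) auto
    show "continuous_on {m - 2..m + 2} F"
      \<comment> \<open>For \<open>q = 1\<close> and \<open>q = -1\<close> the argument of \<open>arctan\<close> is singular at one endpoint, but its coefficient vanishes.\<close>
    proof (cases "\<bar>q\<bar> = 1")
      case True
      then have "q = 1 \<or> q = -1" by linarith
      then have "q - 1 / q = 0" by auto
      then have "F = (\<lambda>x. S x - 2 / q * arccos ((x - m) / 2))"
        by (simp add: F_def fun_eq_iff)
      then show ?thesis using cS cA by (simp only:) (intro continuous_on_diff continuous_on_mult continuous_on_const)
    next
      case False
      then have "\<forall>x\<in>{m - 2..m + 2}. 2 * q + (x - m) \<noteq> 0" using assms by auto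
      then show ?thesis unfolding F_def using cS cA by (intro continuous_intros) auto
    qed
  next
    fix x assume x: "x \<in> {m - 2<..<m + 2}"
    define u where "u = x - m"
    have u: "\<bar>u\<bar> < 2" using x by (auto simp: u_def)
    have u4: "4 - u\<^sup>2 > 0" using power_strict_mono[OF u, of 2] by simp
    define T where "T = S x"
    have T: "T > 0" "T\<^sup>2 = 4 - u\<^sup>2" using u4 by (auto simp: T_def S_def u_def)
    have wu: "q + 1 / q + u \<noteq> 0"
    proof
      assume "q + 1 / q + u = 0"
      then have "(q + 1 / q)\<^sup>2 = u\<^sup>2" by (metis add.inverse_inverse eq_neg_iff_add_eq_0 power2_minus)
      moreover have "(q + 1 / q)\<^sup>2 = 4 + (q - 1 / q)\<^sup>2" using q0 by (simp add: power2_eq_square field_simps)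
      ultimately show False using u4 zero_le_power2[of "q - 1 / q"] by linarith
    qed
    have qu: "2 * q + u \<noteq> 0" using assms u by auto
    have dS: "(S has_real_derivative (- u / T)) (at x)"
      unfolding S_def T_def u_def using u4
      by (auto intro!: derivative_eq_intros simp: u_def field_simps)
    have s1: "sqrt (1 - (u / 2)\<^sup>2) = T / 2"
    proof (rule real_sqrt_unique)
      show "(T / 2)\<^sup>2 = 1 - (u / 2)\<^sup>2" using T by (simp add: power_divide)
    qed (use T in auto)
    have dA: "((\<lambda>x. arccos ((x - m) / 2)) has_real_derivative (- 1 / T)) (at x)"
      by (rule DERIV_cong, rule DERIV_chain2[where g = "\<lambda>x. (x - m) / 2", OF DERIV_arccos])
         (use u s1 T in \<open>auto intro!: derivative_eq_intros simp: u_def[symmetric] field_simps\<close>)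
    have dQ: "((\<lambda>x. S x / (2 * q + (x - m))) has_real_derivative
        ((- u / T) * (2 * q + u) - T) / (2 * q + u)\<^sup>2) (at x)"
      by (rule DERIV_cong, rule DERIV_divide, rule dS)
         (use qu in \<open>auto intro!: derivative_eq_intros simp: u_def T_def power2_eq_square\<close>)
    have dT: "((\<lambda>x. arctan (S x / (2 * q + (x - m)))) has_real_derivative
        (- (q * u + 2) / (2 * q * T * (q + 1 / q + u)))) (at x)"
    proof (rule DERIV_cong)
      show "((\<lambda>x. arctan (S x / (2 * q + (x - m)))) has_real_derivative
         inverse (1 + (T / (2 * q + u))\<^sup>2) * (((- u / T) * (2 * q + u) - T) / (2 * q + u)\<^sup>2)) (at x)"
        using DERIV_chain2[OF DERIV_arctan dQ] by (simp add: u_def T_def)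
      have "1 + (T / (2 * q + u))\<^sup>2 = ((2 * q + u)\<^sup>2 + T\<^sup>2) / (2 * q + u)\<^sup>2"
        using qu by (simp add: power_divide add_divide_distrib)
      also have "(2 * q + u)\<^sup>2 + T\<^sup>2 = 4 * q * (q + 1 / q + u)"
        using T q0 by (simp add: power2_eq_square algebra_simps)
      finally have 1: "1 + (T / (2 * q + u))\<^sup>2 = 4 * q * (q + 1 / q + u) / (2 * q + u)\<^sup>2" .
      have "(- u / T) * (2 * q + u) - T = (- u * (2 * q + u) - T\<^sup>2) / T"
        using T by (simp add: power2_eq_square field_simps)
      also have "- u * (2 * q + u) - T\<^sup>2 = - 2 * (q * u + 2)"
        using T by (simp add: power2_eq_square algebra_simps)
      finally have 2: "(- u / T) * (2 * q + u) - T = - 2 * (q * u + 2) / T" .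
      show "inverse (1 + (T / (2 * q + u))\<^sup>2) * (((- u / T) * (2 * q + u) - T) / (2 * q + u)\<^sup>2)
        = - (q * u + 2) / (2 * q * T * (q + 1 / q + u))"
        unfolding 1 2 using qu T q0 wu by (simp add: divide_simps) (simp add: algebra_simps)
    qed
    have "(F has_real_derivative (- u / T - 2 / q * (- 1 / T)
        - 2 * (q - 1 / q) * (- (q * u + 2) / (2 * q * T * (q + 1 / q + u))))) (at x)"
      unfolding F_def by (intro DERIV_diff DERIV_cmult dS dA dT)
    also have "- u / T - 2 / q * (- 1 / T)
        - 2 * (q - 1 / q) * (- (q * u + 2) / (2 * q * T * (q + 1 / q + u)))
      = ((2 / q - u) * (q + 1 / q + u) + (q - 1 / q) * (u + 2 / q)) / (T * (q + 1 / q + u))"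
    proof -
      define w where "w = q + 1 / q + u"
      have "w \<noteq> 0" using wu by (simp add: w_def)
      then show ?thesis unfolding w_def[symmetric] using q0 T by (simp add: field_simps)
    qed
    also have "(2 / q - u) * (q + 1 / q + u) + (q - 1 / q) * (u + 2 / q) = T\<^sup>2"
      unfolding T(2) using q0 by (simp add: field_simps power2_eq_square)
    also have "T\<^sup>2 / (T * (q + 1 / q + u)) = S x / (q + 1 / q + (x - m))"
      using T(1) by (simp add: power2_eq_square T_def u_def)
    finally show "(F has_vector_derivative S x / (q + 1 / q + (x - m))) (at x)"
      by (simp add: has_real_derivative_iff_has_vector_derivative)
  qed
  also have "F (m + 2) - F (m - 2) = 2 * pi / q"
    by (simp add: F_def S_def)
  finally show ?thesis by (simp add: S_def)
qed

section \<open>Total variation distance to a measure with mass moved to an atom\<close>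

lemma nn_integral_add_measure:
  assumes "sets N = sets M" and "f \<in> borel_measurable M"
  shows "(\<integral>\<^sup>+x. f x \<partial>add_measure M N) = (\<integral>\<^sup>+x. f x \<partial>M) + (\<integral>\<^sup>+x. f x \<partial>N)"
  using assms(2)
proof (induction rule: borel_measurable_induct)
  case (cong f g)
  then show ?case
    using nn_integral_cong[of M f g] nn_integral_cong[of N f g]
      nn_integral_cong[of "add_measure M N" f g] sets_eq_imp_space_eq[OF assms(1)] by simp
next
  case (set A)
  then show ?case using assms(1) by (simp add: emeasure_add_measure)
next
  case (mult u c)
  moreover have "u \<in> borel_measurable N" "u \<in> borel_measurable (add_measure M N)"
    using mult assms(1) by (simp_all cong: measurable_cong_sets)
  ultimately show ?case by (simp add: nn_integral_cmult distrib_left)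
next
  case (add u v)
  moreover have "u \<in> borel_measurable N" "u \<in> borel_measurable (add_measure M N)"
    "v \<in> borel_measurable N" "v \<in> borel_measurable (add_measure M N)"
    using add assms(1) by (simp_all cong: measurable_cong_sets)
  ultimately show ?case by (simp add: nn_integral_add ac_simps)
next
  case (seq U)
  have m: "U i \<in> borel_measurable N" "U i \<in> borel_measurable (add_measure M N)" for i
    using seq assms(1) by (simp_all cong: measurable_cong_sets)
  have mono: "incseq (\<lambda>i. \<integral>\<^sup>+x. U i x \<partial>K)" for K
    using seq(3) by (auto simp: incseq_def le_fun_def intro!: nn_integral_mono)
  show ?case
    using seq m mono by (simp add: nn_integral_monotone_convergence_SUP ennreal_SUP_add image_comp)
qed

text \<open>Off the atom the second measure is dominated by the first, so its surplus on any set is at most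
  the atom's mass \<open>m\<close>; passing to complements bounds its deficit in the same way. The set \<open>{p}\<close>
  attains the bound because \<open>N\<close> does not charge \<open>p\<close>.\<close>
lemma tv_dist_truncation:
  fixes N :: "real measure" and f :: "real \<Rightarrow> real"
  assumes "prob_space N" and [measurable_cong]: "sets N = sets borel"
    and f[measurable]: "f \<in> borel_measurable borel"
    and "AE x in N. f x \<le> 1"
    and "m \<ge> 0" and mass: "(\<integral>\<^sup>+x. ennreal (f x) \<partial>N) = ennreal (1 - m)" and "m \<le> 1"
    and p: "emeasure N {p} = 0"
  shows "tv_dist N (add_measure (density N (\<lambda>x. ennreal (f x)))
           (scale_measure (ennreal m) (return borel p))) = m"
proof -
  interpret N: prob_space N by fact
  let ?E = "add_measure (density N (\<lambda>x. ennreal (f x))) (scale_measure (ennreal m) (return borel p))"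
  have spN: "space N = UNIV" using sets_eq_imp_space_eq[OF assms(2)] by simp
  have E: "emeasure ?E B = (\<integral>\<^sup>+x\<in>B. ennreal (f x) \<partial>N) + ennreal m * indicator B p"
    if "B \<in> sets borel" for B
    using that by (simp add: emeasure_add_measure emeasure_density assms(2))
  interpret E: prob_space ?E
  proof
    have "emeasure ?E UNIV = ennreal (1 - m) + ennreal m"
      using mass by (simp add: E)
    then show "emeasure ?E (space ?E) = 1"
      using assms by (simp add: spN ennreal_plus[symmetric] del: ennreal_plus)
  qed
  have up: "measure ?E B - measure N B \<le> m" if B: "B \<in> sets borel" for B
  proof -
    have "emeasure ?E B \<le> (\<integral>\<^sup>+x. indicator B x \<partial>N) + ennreal m * 1"
      unfolding E[OF B] using \<open>AE x in N. f x \<le> 1\<close>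
      by (intro add_mono nn_integral_mono_AE mult_left_mono)
         (auto simp: indicator_def elim!: eventually_mono)
    also have "\<dots> = emeasure N B + ennreal m" using B assms(2) by simp
    finally have "ennreal (measure ?E B) \<le> ennreal (measure N B + m)"
      using \<open>m \<ge> 0\<close> by (simp add: E.emeasure_eq_measure N.emeasure_eq_measure ennreal_plus[symmetric] del: ennreal_plus)
    then show ?thesis using \<open>m \<ge> 0\<close> by (subst (asm) ennreal_le_iff) auto
  qed
  have bound: "\<bar>measure N B - measure ?E B\<bar> \<le> m" if B: "B \<in> sets borel" for B
  proof -
    have "measure ?E (UNIV - B) = 1 - measure ?E B" "measure N (UNIV - B) = 1 - measure N B"
      using E.prob_compl[of B] N.prob_compl[of B] B assms(2) by (simp_all add: spN)
    then show ?thesis using up[OF B] up[of "UNIV - B"] B by auto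
  qed
  have "(\<integral>\<^sup>+x\<in>{p}. ennreal (f x) \<partial>N) = 0"
    using p assms(2) by (intro nn_integral_null_set) auto
  then have "emeasure ?E {p} = ennreal m" by (simp add: E)
  then have at: "\<bar>measure N {p} - measure ?E {p}\<bar> = m"
    using p \<open>m \<ge> 0\<close> by (simp add: measure_def)
  show ?thesis
    unfolding tv_dist_def
  proof (rule antisym)
    show "(SUP B\<in>sets borel. \<bar>measure N B - measure ?E B\<bar>) \<le> m"
      by (rule cSUP_least) (use bound in auto)
    show "m \<le> (SUP B\<in>sets borel. \<bar>measure N B - measure ?E B\<bar>)"
      by (rule cSUP_upper2[where x = "{p}"]) (use bound at in \<open>auto intro!: bdd_aboveI2\<close>)
  qed
qed

section \<open>The measures \<open>nu s\<close> and \<open>eta c s\<close> have total mass one\<close>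

definition nu_dens :: "nat \<Rightarrow> real \<Rightarrow> real" where
  "nu_dens s x = sqrt (4 - (x - sqrt s)\<^sup>2) / (2 * pi * (x * sqrt s + 1))"

lemma sets_nu [simp, measurable_cong]: "sets (nu s) = sets borel"
  by (simp add: nu_def)

lemma nu_dens_nonneg:
  assumes "s \<ge> 1" and "\<bar>x - sqrt s\<bar> \<le> 2"
  shows "nu_dens s x \<ge> 0"
proof -
  have "(sqrt s - 1)\<^sup>2 \<ge> 0" by simp
  then have "(sqrt s - 2) * sqrt s + 1 \<ge> 0"
    by (simp add: power2_eq_square algebra_simps)
  also have "(sqrt s - 2) * sqrt s + 1 \<le> x * sqrt s + 1"
    using assms by (intro add_right_mono mult_right_mono) auto
  moreover have "(x - sqrt s)\<^sup>2 \<le> 2\<^sup>2"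
    using assms(2) by (subst abs_le_square_iff[symmetric]) simp
  ultimately show ?thesis
    unfolding nu_dens_def by (intro divide_nonneg_nonneg mult_nonneg_nonneg) auto
qed

lemma nn_integral_nu:
  assumes s: "s \<ge> 1" and g[measurable]: "g \<in> borel_measurable borel"
    and pos: "\<And>x. \<bar>x - sqrt s\<bar> \<le> 2 \<Longrightarrow> g x \<ge> 0" "g (- 1 / sqrt s) \<ge> 0"
    and I: "((\<lambda>x. nu_dens s x * g x) has_integral I) {sqrt s - 2..sqrt s + 2}"
  shows "(\<integral>\<^sup>+x. ennreal (g x) \<partial>nu s) = ennreal (I + (1 - 1 / s) * g (- 1 / sqrt s))"
proof -
  let ?S = "{sqrt s - 2..sqrt s + 2}"
  have S: "\<bar>x - sqrt s\<bar> \<le> 2 \<longleftrightarrow> x \<in> ?S" for x by auto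
  have nn: "nu_dens s x * g x \<ge> 0" if "x \<in> ?S" for x
    using that pos(1)[of x] nu_dens_nonneg[OF s, of x] by (simp add: S del: atLeastAtMost_iff)
  have [measurable]: "nu_dens s \<in> borel_measurable borel"
    unfolding nu_dens_def by measurable
  have "(\<integral>\<^sup>+x. ennreal (g x) \<partial>nu s)
      = (\<integral>\<^sup>+x. ennreal (nu_dens s x * indicator ?S x) * ennreal (g x) \<partial>lborel)
        + ennreal (1 - 1 / s) * ennreal (g (- 1 / sqrt s))"
    unfolding nu_def S
    by (simp add: nn_integral_add_measure nn_integral_density nn_integral_scale_measure
        nn_integral_return nu_dens_def indicator_def)
  also have "(\<integral>\<^sup>+x. ennreal (nu_dens s x * indicator ?S x) * ennreal (g x) \<partial>lborel)
      = (\<integral>\<^sup>+x. ennreal (if x \<in> ?S then nu_dens s x * g x else 0) \<partial>lborel)"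
    using nu_dens_nonneg[OF s] pos(1) S
    by (intro nn_integral_cong) (auto simp: indicator_def ennreal_mult)
  also have "\<dots> = ennreal I"
  proof (rule nn_integral_has_integral_lborel)
    show "((\<lambda>x. if x \<in> ?S then nu_dens s x * g x else 0) has_integral I) UNIV"
      using I by (simp only: has_integral_restrict_UNIV)
  qed (use nn in \<open>auto simp del: atLeastAtMost_iff\<close>)
  also have "ennreal I + ennreal (1 - 1 / s) * ennreal (g (- 1 / sqrt s))
      = ennreal (I + (1 - 1 / s) * g (- 1 / sqrt s))"
    using s pos(2) has_integral_nonneg[OF I nn] by (simp add: ennreal_mult ennreal_plus)
  finally show ?thesis .
qed

lemma AE_nu_le: "AE x in nu s. x \<le> sqrt s + 2"
proof (rule AE_I)
  have "- 1 / sqrt s \<le> sqrt s + 2"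
    by (rule order_trans[of _ 0]) auto
  moreover have "emeasure (density lborel (\<lambda>x. ennreal
        (sqrt (4 - (x - sqrt s)\<^sup>2) / (2 * pi * (x * sqrt s + 1))
          * indicator {y. \<bar>y - sqrt s\<bar> \<le> 2} x))) {sqrt s + 2<..} = 0"
    by (subst emeasure_density) (auto intro!: nn_integral_zero' AE_I2 simp: indicator_def)
  ultimately show "emeasure (nu s) {sqrt s + 2<..} = 0"
    by (simp add: nu_def emeasure_add_measure)
qed auto

lemma prob_space_nu:
  assumes s: "s \<ge> 1"
  shows "prob_space (nu s)"
proof
  have q: "sqrt s \<ge> 1" using s by simp
  have "((\<lambda>x. 1 / (2 * pi * sqrt s) * (sqrt (4 - (x - sqrt s)\<^sup>2) / (sqrt s + 1 / sqrt s + (x - sqrt s))))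
      has_integral 1 / (2 * pi * sqrt s) * (2 * pi / sqrt s)) {sqrt s - 2..sqrt s + 2}"
    using q by (intro has_integral_mult_right has_integral_semicircle_cauchy) auto
  also have "(\<lambda>x. 1 / (2 * pi * sqrt s) * (sqrt (4 - (x - sqrt s)\<^sup>2) / (sqrt s + 1 / sqrt s + (x - sqrt s))))
      = (\<lambda>x. nu_dens s x * 1)"
  proof
    fix x
    have "(2 * pi * sqrt s) * (sqrt s + 1 / sqrt s + (x - sqrt s)) = 2 * pi * (x * sqrt s + 1)"
      using s by (simp add: field_simps)
    then show "1 / (2 * pi * sqrt s) * (sqrt (4 - (x - sqrt s)\<^sup>2) / (sqrt s + 1 / sqrt s + (x - sqrt s)))
        = nu_dens s x * 1"
      unfolding nu_dens_def by (simp only: times_divide_times_eq mult_1 mult_1_right)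
  qed
  also have "1 / (2 * pi * sqrt s) * (2 * pi / sqrt s) = 1 / s"
    using s by (simp add: field_simps)
  finally have "(\<integral>\<^sup>+x. ennreal 1 \<partial>nu s) = ennreal (1 / s + (1 - 1 / s) * 1)"
    by (intro nn_integral_nu[OF s]) auto
  then show "emeasure (nu s) (space (nu s)) = 1" by simp
qed

text \<open>The mass that \<open>f_dens s c\<close> leaves on the support of \<open>nu s\<close> when \<open>t = exp c\<close> is small, that is,
  one minus the weight of the atom of \<open>eta c s\<close>.\<close>
definition retained_mass :: "nat \<Rightarrow> real \<Rightarrow> real" where
  "retained_mass s t = t * (t + sqrt s) / (1 + sqrt s * t)"

text \<open>With \<open>z = t + 1 / t + sqrt s\<close>, the product of the two densities splits as a multiple of
  \<open>sqrt s / (x * sqrt s + 1) + 1 / (z - x)\<close>: two Cauchy kernels against the semicircle, with poles at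
  \<open>-1 / sqrt s\<close> (\<open>q = sqrt s\<close>) and at \<open>z\<close> (\<open>q = - 1 / t\<close>).\<close>
lemma nn_integral_f_dens_nu:
  assumes s: "s \<ge> 1" and c: "sqrt s + 2 \<le> exp (- c)"
  shows "(\<integral>\<^sup>+x. ennreal (f_dens s c x) \<partial>nu s) = ennreal (retained_mass s (exp c))"
proof -
  define t where "t = exp c"
  define z where "z = t + 1 / t + sqrt s"
  have t: "t > 0" "sqrt s + 2 \<le> 1 / t"
    using c by (auto simp: t_def exp_minus inverse_eq_divide)
  have q: "sqrt s \<ge> 1" using s by simp
  have t1: "1 / t \<ge> 1" using t q by linarith
  have f: "f_dens s c x = (t + sqrt s) / (z - x)" for x
    by (simp add: f_dens_def t_def z_def exp_minus inverse_eq_divide)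
  have zx: "z - x > 0" if "x \<le> sqrt s + 2" for x
    using that t q unfolding z_def by linarith
  have zs: "z * sqrt s + 1 > 0" using t q unfolding z_def by (intro add_pos_pos mult_pos_pos) auto
  let ?S = "{sqrt s - 2..sqrt s + 2}"
  let ?\<sigma> = "\<lambda>x. sqrt (4 - (x - sqrt s)\<^sup>2)"
  let ?k = "(t + sqrt s) / (2 * pi * (z * sqrt s + 1))"
  have "((\<lambda>x. ?k * (?\<sigma> x / (sqrt s + 1 / sqrt s + (x - sqrt s))
            - ?\<sigma> x / (- (1 / t) + 1 / (- (1 / t)) + (x - sqrt s))))
      has_integral ?k * (2 * pi / sqrt s - 2 * pi / (- (1 / t)))) ?S"
    using q t1 t(1) by (intro has_integral_mult_right has_integral_diff has_integral_semicircle_cauchy) auto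
  then have I: "((\<lambda>x. nu_dens s x * f_dens s c x)
      has_integral ?k * (2 * pi / sqrt s - 2 * pi / (- (1 / t)))) ?S"
    \<comment> \<open>The pole \<open>-1 / sqrt s\<close> lies in the interval only for \<open>s = 1\<close>, as an endpoint; discarding it
      justifies dividing by \<open>y\<close>.\<close>
  proof (rule has_integral_spike[rotated 2])
    fix x assume x: "x \<in> ?S - {- 1 / sqrt s}"
    define y where "y = x * sqrt s + 1"
    have y: "y \<noteq> 0" using x q by (auto simp: y_def field_simps)
    define d where "d = z - x"
    have d: "d > 0" using x zx by (simp add: d_def)
    have "sqrt s + 1 / sqrt s + (x - sqrt s) = y / sqrt s"
      using q by (simp add: y_def field_simps)
    moreover have "- (1 / t) + 1 / (- (1 / t)) + (x - sqrt s) = - d"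
      by (simp add: z_def d_def)
    moreover have W: "z * sqrt s + 1 = y + sqrt s * d"
      by (simp add: y_def d_def algebra_simps)
    moreover have "?\<sigma> x / (y / sqrt s) - ?\<sigma> x / (- d) = ?\<sigma> x * (y + sqrt s * d) / (y * d)"
      using y d by (simp add: add_divide_distrib distrib_left)
    ultimately show "nu_dens s x * f_dens s c x
      = ?k * (?\<sigma> x / (sqrt s + 1 / sqrt s + (x - sqrt s))
            - ?\<sigma> x / (- (1 / t) + 1 / (- (1 / t)) + (x - sqrt s)))"
      using zs unfolding nu_dens_def f y_def[symmetric] d_def[symmetric] by simp (simp add: ac_simps)
  qed simp
  have m1: "- 1 / sqrt s \<le> sqrt s + 2"
    by (rule order_trans[of _ 0]) auto
  have pos: "f_dens s c x \<ge> 0" if "x \<le> sqrt s + 2" for x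
    using zx[OF that] t q by (simp add: f)
  have meas: "f_dens s c \<in> borel_measurable borel"
    unfolding f_dens_def by measurable
  have "(\<integral>\<^sup>+x. ennreal (f_dens s c x) \<partial>nu s)
      = ennreal (?k * (2 * pi / sqrt s - 2 * pi / (- (1 / t))) + (1 - 1 / s) * f_dens s c (- 1 / sqrt s))"
    by (rule nn_integral_nu[OF s meas _ _ I]) (use pos m1 in auto)
  also have "?k * (2 * pi / sqrt s - 2 * pi / (- (1 / t))) + (1 - 1 / s) * f_dens s c (- 1 / sqrt s)
      = retained_mass s t"
  proof -
    define p where "p = sqrt s"
    have s_eq: "real s = p * p" by (simp add: p_def)
    have p: "p > 0" using q by (simp add: p_def)
    have D: "1 + p * t > 0" "t + p > 0" using p t by (simp_all add: add_pos_pos)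
    have zp: "z * p + 1 = (t + p) * (1 + p * t) / t"
      using t by (simp add: z_def p_def[symmetric] field_simps)
    have zm: "z - (- 1 / p) = (t + p) * (1 + p * t) / (p * t)"
      using zp p t by (simp add: field_simps)
    have "(t + p) / (2 * pi * (z * p + 1)) * (2 * pi / p - 2 * pi / (- (1 / t))) = t / p"
      unfolding zp using D p t by (simp add: divide_simps) (simp add: algebra_simps)
    moreover have "(t + p) / (z - (- 1 / p)) = p * t / (1 + p * t)"
      unfolding zm using D p t by simp
    moreover have "t / p + (1 - 1 / (p * p)) * (p * t / (1 + p * t)) = t * (t + p) / (1 + p * t)"
      using D p t by (simp add: divide_simps) (simp add: algebra_simps)
    moreover have "sqrt (p * p) = p" using p by simp
    ultimately show ?thesis by (simp only: f retained_mass_def s_eq)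
  qed
  finally show ?thesis by (simp add: t_def)
qed

section \<open>The profile near minus infinity\<close>

text \<open>The hypothesis on \<open>c\<close> says that \<open>exp (- c)\<close>, the point where \<open>f_dens s c\<close> crosses the value
  \<open>1\<close>, lies to the right of the support of \<open>nu s\<close>.\<close>
lemma profile_left_tail:
  assumes s: "s \<ge> 1" and c: "sqrt s + 2 \<le> exp (- c)"
  shows "profile s c = 1 - retained_mass s (exp c)"
proof -
  define t where "t = exp c"
  have t: "t > 0" "sqrt s + 2 \<le> 1 / t"
    using c by (auto simp: t_def exp_minus inverse_eq_divide)
  have q: "sqrt s \<ge> 1" using s by simp
  have "1 / t > 1" using t q by linarith
  then have t1: "t < 1" using t by simp
  then have c0: "c < 0" by (simp add: t_def)
  have e0: "retained_mass s t \<ge> 0" "retained_mass s t \<le> 1"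
  proof -
    show "retained_mass s t \<ge> 0" using t by (simp add: retained_mass_def)
    have "t * t \<le> 1" using t t1 by (simp add: mult_le_one)
    moreover have "1 + sqrt s * t > 0" using t q by (intro add_pos_nonneg) auto
    ultimately show "retained_mass s t \<le> 1" by (simp add: retained_mass_def algebra_simps)
  qed
  have atom: "indicator {..<0} c * ((exp (- c) - exp c) / (exp (- c) + sqrt s)) = 1 - retained_mass s t"
  proof -
    have D: "1 + sqrt s * t > 0" using t q by (intro add_pos_nonneg) auto
    have "1 / t - t = (1 - t * t) / t" and "1 / t + sqrt s = (1 + sqrt s * t) / t"
      using t by (simp_all add: field_simps)
    then have "(1 / t - t) / (1 / t + sqrt s) = (1 - t * t) / (1 + sqrt s * t)"
      using t by simp
    also have "\<dots> = 1 - retained_mass s t"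
      using D by (simp add: retained_mass_def field_simps)
    finally have "(1 / t - t) / (1 / t + sqrt s) = 1 - retained_mass s t" .
    then show ?thesis using c0 by (simp add: t_def exp_minus inverse_eq_divide)
  qed
  have p: "exp c + sqrt s + exp (- c) > sqrt s + 2"
    using c q exp_gt_zero[of c] by linarith
  have p0: "emeasure (nu s) {exp c + sqrt s + exp (- c)} = 0"
  proof -
    have "AE x in nu s. \<not> x = exp c + sqrt s + exp (- c)"
      using AE_nu_le[of s] by eventually_elim (use p in auto)
    from emeasure_eq_0_AE[OF this] show ?thesis
      using sets_eq_imp_space_eq[OF sets_nu[of s]] by simp
  qed
  have "profile s c = 1 - retained_mass s t"
    unfolding profile_def eta_def atom
  proof (rule tv_dist_truncation[OF prob_space_nu[OF s]])
    show "AE x in nu s. f_dens s c x \<le> 1"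
      using AE_nu_le[of s]
    proof eventually_elim
      case (elim x)
      then have "exp c + exp (- c) + sqrt s - x > 0" using c q exp_gt_zero[of c] by linarith
      then show ?case using elim c by (simp add: f_dens_def)
    qed
    show "(\<integral>\<^sup>+x. ennreal (f_dens s c x) \<partial>nu s) = ennreal (1 - (1 - retained_mass s t))"
      using nn_integral_f_dens_nu[OF s c] by (simp add: t_def)
    show "f_dens s c \<in> borel_measurable borel"
      unfolding f_dens_def by measurable
  qed (use e0 p0 in auto)
  then show ?thesis by (simp add: t_def)
qed

lemma ln_retained_mass_asymptotics:
  assumes "s \<ge> 1"
  shows "((\<lambda>c. ln (retained_mass s (exp c)) - c) \<longlongrightarrow> ln (sqrt s)) at_bot"
proof -
  have q: "sqrt s > 0" using assms by simp
  have "((\<lambda>c. ln ((exp c + sqrt s) / (1 + sqrt s * exp c))) \<longlongrightarrow> ln ((0 + sqrt s) / (1 + sqrt s * 0))) at_bot"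
    using q by (intro tendsto_intros exp_at_bot) auto
  moreover have "ln (retained_mass s (exp c)) - c = ln ((exp c + sqrt s) / (1 + sqrt s * exp c))" for c
  proof -
    have "(exp c + sqrt s) / (1 + sqrt s * exp c) > 0"
      using q by (intro divide_pos_pos add_pos_pos mult_pos_pos) auto
    then have "ln (exp c * ((exp c + sqrt s) / (1 + sqrt s * exp c)))
        = c + ln ((exp c + sqrt s) / (1 + sqrt s * exp c))"
      by (subst ln_mult) auto
    then show ?thesis by (simp add: retained_mass_def)
  qed
  ultimately show ?thesis by simp
qed

lemma affine_tendsto_at_bot:
  fixes k b l :: real
  assumes "((\<lambda>c. k * c + b) \<longlongrightarrow> l) at_bot"
  shows "k = 0 \<and> b = l"
proof -
  have "((\<lambda>c. (k * c + b - b) / c) \<longlongrightarrow> 0) at_bot"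
    by (intro tendsto_divide_0[OF tendsto_diff[OF assms tendsto_const]] filterlim_at_bot_imp_at_infinity filterlim_ident)
  moreover have "eventually (\<lambda>c::real. (k * c + b - b) / c = k) at_bot"
    using eventually_le_at_bot[of "-1::real"] by eventually_elim auto
  ultimately have "((\<lambda>c::real. k) \<longlongrightarrow> 0) at_bot"
    by (simp add: tendsto_cong)
  then have "k = 0" by (simp add: tendsto_const_iff)
  then show ?thesis using assms by (simp add: tendsto_const_iff)
qed

section \<open>Recovering the parameter\<close>

theorem proposition4p7:
  fixes r s :: nat
  assumes "r \<ge> 1" and "s \<ge> 1"
    and "\<exists>a b :: real. a > 0 \<and> (\<forall>c :: real. profile r (a * c + b) = profile s c)"
  shows "r = s"
proof -
  obtain a b :: real where a: "a > 0" and eq: "\<And>c. profile r (a * c + b) = profile s c"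
    using assms(3) by blast
  have q: "sqrt r > 0" "sqrt s > 0" using assms by auto
  have lim: "filterlim (\<lambda>c. a * c + b) at_bot at_bot"
    unfolding filterlim_at_bot
  proof
    fix Z :: real
    show "eventually (\<lambda>c. a * c + b \<le> Z) at_bot"
      using eventually_le_at_bot[of "(Z - b) / a"]
      by eventually_elim (use a in \<open>simp add: field_simps\<close>)
  qed
  have tail: "eventually (\<lambda>c. sqrt n + 2 \<le> exp (- c)) at_bot" for n :: nat
    using eventually_le_at_bot[of "- ln (sqrt n + 2)"]
  proof eventually_elim
    case (elim c)
    have "exp (ln (sqrt n + 2)) \<le> exp (- c)" using elim by (subst exp_le_cancel_iff) simp
    moreover have "sqrt n + 2 > 0" by (intro add_nonneg_pos) auto
    ultimately show ?case by simp
  qed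
  have ex: "eventually (\<lambda>c. retained_mass r (exp (a * c + b)) = retained_mass s (exp c)) at_bot"
    using tail[of s] eventually_compose_filterlim[OF tail[of r] lim]
  proof eventually_elim
    case (elim c)
    then show ?case
      using eq[of c] profile_left_tail[OF assms(2)] profile_left_tail[OF assms(1)] by simp
  qed
  \<comment> \<open>Subtracting the two logarithmic asymptotics leaves an affine function of \<open>c\<close> with a finite
    limit, which must be constant.\<close>
  have "((\<lambda>c. (ln (retained_mass s (exp c)) - c) - (ln (retained_mass r (exp (a * c + b))) - (a * c + b)))
      \<longlongrightarrow> ln (sqrt s) - ln (sqrt r)) at_bot"
    using filterlim_compose[OF ln_retained_mass_asymptotics[OF assms(1)] lim]
    by (intro tendsto_diff ln_retained_mass_asymptotics[OF assms(2)]) 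
  moreover have "eventually (\<lambda>c. (ln (retained_mass s (exp c)) - c) - (ln (retained_mass r (exp (a * c + b))) - (a * c + b))
      = (a - 1) * c + b) at_bot"
    using ex by eventually_elim (simp add: algebra_simps)
  ultimately have "((\<lambda>c. (a - 1) * c + b) \<longlongrightarrow> ln (sqrt s) - ln (sqrt r)) at_bot"
    by (simp add: tendsto_cong)
  from affine_tendsto_at_bot[OF this] have a1: "a = 1" and b: "b = ln (sqrt s) - ln (sqrt r)" by auto
  define B where "B = exp b"
  have B: "B > 0" "B * sqrt r = sqrt s" using q by (simp_all add: B_def b exp_diff)
  from eventually_happens[OF ex] obtain c where c: "retained_mass r (exp (a * c + b)) = retained_mass s (exp c)"
    by auto
  define t where "t = exp c"
  have t: "t > 0" "exp (a * c + b) = B * t" by (simp_all add: t_def B_def a1 exp_add)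
  have D: "1 + sqrt s * t > 0" using q t by (intro add_pos_pos) auto
  have "sqrt r * (B * t) = sqrt s * t" using B by (simp add: mult.assoc[symmetric] mult.commute)
  then have "B * t * (B * t + sqrt r) / (1 + sqrt s * t) = t * (t + sqrt s) / (1 + sqrt s * t)"
    using c by (simp only: retained_mass_def t(2) t_def[symmetric])
  then have "t * (B * (B * t + sqrt r)) = t * (t + sqrt s)"
    using D by (simp only: divide_cancel_right) (simp add: ac_simps)
  then have "B * (B * t + sqrt r) = t + sqrt s"
    using t(1) by (simp only: mult_cancel_left) simp
  then have "B * B * t = t" using B by (simp add: algebra_simps)
  then have "B * B = 1" using t by simp
  then have "B = 1" using B by (simp add: square_eq_1_iff)
  then show ?thesis using B by simp
qed

end
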